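(* Let $K$ be a totally ordered (commutative, infinite) idempotent semifield. Then $K$ is algebraically closed if and only if $K$ is preradicable.
   Context: A semiring is a commutative monoid $(S,+,0)$ with an associative multiplication having identity $1$, distributing over $+$, and with $0$ absorbing. A semifield is a semiring with $1\neq 0$ in which every nonzero element has a multiplicative inverse; it is idempotent if $x+x=x$ for all $x$. All idempotent semifields are assumed commutative and infinite. An idempotent semifield $K$ is ordered by $x\leqslant y \iff x+y=y$; it is totally ordered if this order is total. $\mathbb{N}$ contains $0$ and $\mathbb{N}^*=\mathbb{N}\setminus\{0\}$. A polynomial $p\in K[X]$ is a formal polynomial $p=\sum_{j\in\mathbb{N}}p_jX^j$ (eventually zero sequence of coefficients), with polynomial function $\widehat p:K\to K$, $\widehat p(x)=\sum_j p_jx^j$. $K$ is algebraically closed if for every $p\in K[X]$ of degree $n>0$ there are $r_1,\dots,r_n\in K$ with $\widehat p(x)=p_n(x+r_1)\cdots(x+r_n)$ for all $x\in K$. $K$ is preradicable if for all $y\in K$ and $n\in\mathbb{N}^*$ there is a least element $x\in K$ such that $x^n\geqslant y$. *)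

theory Defs
  imports "HOL-Computational_Algebra.Polynomial"
begin

text \<open>Commutative idempotent semifields. The axiom \<open>1 \<noteq> 0\<close> is part of
  \<^class>\<open>comm_semiring_1\<close>. Infinitude is not an axiom of the class; it is stated
  explicitly where it is assumed.\<close>

class idempotent_semifield = comm_semiring_1 + ord +
  assumes mult_inverse_ex: "x \<noteq> 0 \<Longrightarrow> \<exists>y. x * y = 1"
    and add_idem: "x + x = x"
    and le_iff_add_eq: "x \<le> y \<longleftrightarrow> x + y = y"
    and less_iff_le_not_le: "x < y \<longleftrightarrow> x \<le> y \<and> \<not> y \<le> x"
begin

subclass order
proof
  fix x y z :: 'a
  show "x < y \<longleftrightarrow> x \<le> y \<and> \<not> y \<le> x"
    by (rule less_iff_le_not_le)
  show "x \<le> x"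
    by (simp add: le_iff_add_eq add_idem)
  show "x \<le> z" if "x \<le> y" "y \<le> z"
    using that by (metis le_iff_add_eq add.assoc)
  show "x = y" if "x \<le> y" "y \<le> x"
    using that by (metis le_iff_add_eq add.commute)
qed

end

class linordered_idempotent_semifield = idempotent_semifield + linorder

text \<open>The factorisation is an identity of polynomial functions on \<open>K\<close>, not of formal
  polynomials.\<close>

definition algebraically_closed :: "'a::idempotent_semifield itself \<Rightarrow> bool" where
  "algebraically_closed _ \<longleftrightarrow>
    (\<forall>p :: 'a poly. degree p > 0 \<longrightarrow>
      (\<exists>r :: nat \<Rightarrow> 'a. \<forall>x.
        poly p x = coeff p (degree p) * (\<Prod>i = 1..degree p. x + r i)))"

definition preradicable :: "'a::idempotent_semifield itself \<Rightarrow> bool" where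
  "preradicable _ \<longleftrightarrow>
    (\<forall>y :: 'a. \<forall>n :: nat. n > 0 \<longrightarrow>
      (\<exists>x. x ^ n \<ge> y \<and> (\<forall>z. z ^ n \<ge> y \<longrightarrow> x \<le> z)))"

end

theory Submission
  imports Defs
begin

text \<open>Addition is the maximum and the nonzero elements form a totally ordered group. If
  \<open>x^n + y\<close> splits, the largest of its roots is the least \<open>x\<close> with \<open>x^n \<ge> y\<close>, because the
  product of the \<open>x + r\<^sub>i\<close> equals \<open>x^n\<close> exactly from the largest root on. Conversely, for
  a monic \<open>p\<close> of degree \<open>n + 1\<close> let \<open>r\<close> be the least element with \<open>r^(n+1-j) \<ge> p\<^sub>j\<close> for all
  \<open>j \<le> n\<close>. Then \<open>p(x) = (x + r) q(x)\<close>, where \<open>q\<close> is monic of degree \<open>n\<close> with lower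
  coefficients \<open>p\<^sub>j / r\<close>, and one inducts on the degree. The only delicate point is
  \<open>r x^n \<le> p(x)\<close> for \<open>x < r\<close>: otherwise, for the \<open>j\<close> that determines \<open>r\<close>, the element
  \<open>p\<^sub>j / x^(n+1-j)\<close> lies strictly between \<open>1\<close> and \<open>r / x\<close>, so some \<open>e > 1\<close> has
  \<open>e^2 \<le> r / x\<close>, and \<open>r / e\<close> contradicts the minimality of \<open>r\<close>.\<close>

\<comment> \<open>Order and cancellation in idempotent semifields\<close>
subclass (in idempotent_semifield) ordered_comm_semiring
proof
  fix a b c :: 'a
  assume "a \<le> b"
  then have ab: "a + b = b" by (simp add: le_iff_add_eq)
  have "(c + a) + (c + b) = (c + c) + (a + b)" by (simp only: ac_simps)
  then show "c + a \<le> c + b" by (simp add: le_iff_add_eq add_idem ab)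
  show "c * a \<le> c * b" by (simp add: le_iff_add_eq ab flip: distrib_left)
qed

\<comment> \<open>The witness \<open>c\<close> for \<open>a \<le> b\<close> is \<open>b\<close>
  itself. The instance supplies \<open>zero_le\<close>, so multiplication is monotone without sign
  conditions.\<close>
subclass (in idempotent_semifield) canonically_ordered_monoid_add
proof
  fix a b :: 'a
  have "a \<le> a + c" for c by (simp add: le_iff_add_eq add_idem flip: add.assoc)
  moreover have "b = a + b" if "a \<le> b" using that by (simp add: le_iff_add_eq)
  ultimately show "a \<le> b \<longleftrightarrow> (\<exists>c. b = a + c)" by blast
qed

context idempotent_semifield
begin

lemma add_absorb: "a \<le> b \<Longrightarrow> a + b = b" "a \<le> b \<Longrightarrow> b + a = b"
  by (simp_all add: le_iff_add_eq add.commute)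

lemma add_le_iff: "a + b \<le> c \<longleftrightarrow> a \<le> c \<and> b \<le> c"
proof
  assume "a + b \<le> c"
  moreover have "a \<le> a + b" "b \<le> a + b"
    by (simp_all add: add_increasing add_increasing2)
  ultimately show "a \<le> c \<and> b \<le> c" using order_trans by blast
next
  assume "a \<le> c \<and> b \<le> c"
  then have "a + b \<le> c + c" by (intro add_mono) auto
  then show "a + b \<le> c" by (simp add: add_idem)
qed

lemma sum_le_iff: "finite A \<Longrightarrow> sum f A \<le> c \<longleftrightarrow> (\<forall>i\<in>A. f i \<le> c)"
  by (induction A rule: finite_induct) (simp_all add: add_le_iff)

lemma mult_le_cancel:
  assumes "c \<noteq> 0"
  shows "c * a \<le> c * b \<longleftrightarrow> a \<le> b"
proof
  obtain d where d: "c * d = 1" using mult_inverse_ex[OF assms] by blast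
  have cancel: "d * (c * z) = z" for z
    using d by (simp add: mult.commute[of d c] flip: mult.assoc)
  assume "c * a \<le> c * b"
  from mult_left_mono[OF this zero_le, of d] show "a \<le> b" by (simp only: cancel)
qed (rule mult_left_mono[OF _ zero_le])

lemma mult_nonzero:
  assumes "a \<noteq> 0" "b \<noteq> 0"
  shows "a * b \<noteq> 0"
proof
  obtain c where c: "a * c = 1" using mult_inverse_ex[OF assms(1)] by blast
  assume "a * b = 0"
  moreover have "b = c * (a * b)"
    using c by (simp add: mult.commute[of c a] flip: mult.assoc)
  ultimately show False using assms(2) by simp
qed

lemma power_nonzero: "a \<noteq> 0 \<Longrightarrow> a ^ n \<noteq> 0"
  by (induction n) (auto simp: mult_nonzero)

lemma mult_mono_semifield: "a \<le> b \<Longrightarrow> c \<le> d \<Longrightarrow> a * c \<le> b * d"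
  by (simp add: mult_mono)

lemma power_mono_semifield: "a \<le> b \<Longrightarrow> a ^ n \<le> b ^ n"
  by (induction n) (auto intro: mult_mono_semifield)

lemma one_le_power_semifield: "1 \<le> a \<Longrightarrow> 1 \<le> a ^ n"
  using power_mono_semifield[of 1 a n] by simp

lemma prod_mono_semifield: "(\<And>i. i \<in> A \<Longrightarrow> f i \<le> g i) \<Longrightarrow> prod f A \<le> prod g A"
  by (induction A rule: infinite_finite_induct) (auto intro: mult_mono_semifield)

end

lemma mult_less_cancel:
  fixes a b c :: "'a::linordered_idempotent_semifield"
  shows "c \<noteq> 0 \<Longrightarrow> c * a < c * b \<longleftrightarrow> a < b"
  by (metis mult_le_cancel not_le)

section \<open>Least roots and dominating elements\<close>

lemma least_root_mult_power_le:
  fixes r x y :: "'a::linordered_idempotent_semifield"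
  assumes root: "y \<le> r ^ Suc k" and least: "\<And>z. y \<le> z ^ Suc k \<Longrightarrow> r \<le> z"
    and "x < r"
  shows "r * x ^ k \<le> y"
proof (cases "k = 0 \<or> x = 0")
  \<comment> \<open>For \<open>k = 0\<close>, \<open>y\<close> satisfies its own root condition, so
    \<open>r \<le> y\<close>; for \<open>k > 0\<close> and \<open>x = 0\<close> the left side is
    \<open>0\<close>.\<close>
  case True
  then show ?thesis
    using least[of y] by (cases k) auto
next
  case False
  then have k: "k > 0" and x: "x \<noteq> 0" by auto
  obtain a where a: "x * a = 1" using mult_inverse_ex[OF x] by blast
  have xr: "x * (r * a) = r"
    using a by (metis mult.assoc mult.commute mult_1)
  show ?thesis
  proof (rule ccontr)
    assume "\<not> r * x ^ k \<le> y"
    then have lt: "y < r * x ^ k" by simp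
    have gt: "x ^ Suc k < y" using least[of x] \<open>x < r\<close> by (meson not_le)
    \<comment> \<open>As fractions, \<open>s = y / x^(k+1)\<close> and \<open>t = r / x\<close>; the
      two strict bounds on \<open>y\<close> become \<open>1 < s < t\<close>.\<close>
    define s where "s = y * a ^ Suc k"
    define t where "t = r * a"
    have xs: "x ^ Suc k * s = y"
    proof -
      have "x ^ Suc k * s = y * (x * a) ^ Suc k"
        unfolding s_def power_mult_distrib by (simp add: ac_simps)
      then show ?thesis using a by simp
    qed
    have xt: "x ^ Suc k * t = r * x ^ k"
      using xr by (metis t_def power_Suc mult.assoc mult.commute)
    have xk: "x ^ Suc k \<noteq> 0" using x by (rule power_nonzero)
    have s: "1 < s"
      using gt xs mult_less_cancel[OF xk, of 1 s] by simp
    have st: "s < t"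
      using lt xs xt mult_less_cancel[OF xk, of s t] by simp
    have "s \<noteq> 0" using s by (metis not_less zero_le)
    then obtain b where b: "s * b = 1" using mult_inverse_ex by blast
    have tb: "s * (t * b) = t" using b by (metis mult.assoc mult.commute mult_1)
    \<comment> \<open>an element strictly above 1 whose square is at most \<open>t\<close>\<close>
    define e where "e = min s (t * b)"
    have "1 < t * b"
      using mult_less_cancel[OF \<open>s \<noteq> 0\<close>, of 1 "t * b"] tb st by simp
    then have e: "1 < e" using s by (simp add: e_def)
    have "e * e \<le> s * (t * b)" by (rule mult_mono_semifield) (auto simp: e_def)
    then have ee: "e * e \<le> t" using tb by simp
    \<comment> \<open>As \<open>k > 0\<close>, \<open>k + 1 \<le> 2k\<close>, so
      \<open>e^(k+1) \<le> e^(2k) \<le> t^k\<close>.\<close>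
    have "e ^ Suc k \<le> e ^ Suc k * e ^ (k - 1)"
      using mult_mono_semifield[OF order_refl one_le_power_semifield[of e "k - 1"], of "e ^ Suc k"] e
      by simp
    also have "\<dots> = (e * e) ^ k"
    proof -
      have "Suc k + (k - 1) = 2 * k" using k by simp
      then show ?thesis by (simp only: flip: power_add power2_eq_square power_mult)
    qed
    also have "\<dots> \<le> t ^ k" using ee by (rule power_mono_semifield)
    finally have "e ^ Suc k \<le> t ^ k" .
    then have "y * e ^ Suc k \<le> (r * x ^ k) * t ^ k"
      using lt by (intro mult_mono_semifield) auto
    also have "\<dots> = r ^ Suc k"
      using xr by (simp add: t_def mult.assoc flip: power_mult_distrib)
    finally have bound: "y * e ^ Suc k \<le> r ^ Suc k" .
    have "e \<noteq> 0" using e by (metis not_less zero_le)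
    then obtain d where d: "e * d = 1" using mult_inverse_ex by blast
    \<comment> \<open>With \<open>d = 1 / e\<close> the bound reads
      \<open>y \<le> (r / e)^(k+1)\<close>; leastness of \<open>r\<close> then forces
      \<open>e \<le> 1\<close>.\<close>
    have "e ^ Suc k * (r * d) ^ Suc k = r ^ Suc k * (e * d) ^ Suc k"
      unfolding power_mult_distrib by (simp add: ac_simps)
    then have "e ^ Suc k * y \<le> e ^ Suc k * (r * d) ^ Suc k"
      using bound by (simp only: d power_one mult_1_right mult.commute[of _ y])
    then have "y \<le> (r * d) ^ Suc k"
      using mult_le_cancel[OF power_nonzero[OF \<open>e \<noteq> 0\<close>]] by blast
    then have "r \<le> r * d" by (rule least)
    moreover have "r \<noteq> 0" using \<open>x < r\<close> by (metis not_less zero_le)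
    ultimately have "1 \<le> d" using mult_le_cancel[of r 1 d] by simp
    then have "e * 1 \<le> e * d" by (intro mult_mono_semifield) auto
    then show False using d e by simp
  qed
qed

text \<open>Take the maximum of the least roots belonging to the single \<open>f j\<close>.
  Domination follows by monotonicity of powers; an index attaining the maximum has \<open>r\<close>
  as its own least root, so \<open>least_root_mult_power_le\<close> applies to it.\<close>

lemma least_dominating_root:
  fixes f :: "nat \<Rightarrow> 'a::linordered_idempotent_semifield"
  assumes "preradicable TYPE('a)"
  obtains r where "\<And>j. j \<le> n \<Longrightarrow> f j \<le> r ^ (Suc n - j)"
    and "\<And>x. x < r \<Longrightarrow> \<exists>j\<le>n. r * x ^ (n - j) \<le> f j"
proof -
  have "\<forall>j\<le>n. \<exists>x. f j \<le> x ^ Suc (n - j) \<and> (\<forall>z. f j \<le> z ^ Suc (n - j) \<longrightarrow> x \<le> z)"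
    using assms unfolding preradicable_def by blast
  then obtain g where g: "\<And>j. j \<le> n \<Longrightarrow> f j \<le> g j ^ Suc (n - j)"
      "\<And>j z. j \<le> n \<Longrightarrow> f j \<le> z ^ Suc (n - j) \<Longrightarrow> g j \<le> z"
    by metis
  define r where "r = Max (g ` {..n})"
  have "r \<in> g ` {..n}" unfolding r_def by (rule Max_in) auto
  then obtain j where j: "j \<le> n" "r = g j" by auto
  show ?thesis
  proof (rule that)
    fix i assume i: "i \<le> n"
    then have "g i \<le> r" unfolding r_def by simp
    then have "g i ^ Suc (n - i) \<le> r ^ Suc (n - i)" by (rule power_mono_semifield)
    then show "f i \<le> r ^ (Suc n - i)"
      using g(1)[OF i] i by (simp only: Suc_diff_le)
  next
    fix x assume "x < r"
    then show "\<exists>j\<le>n. r * x ^ (n - j) \<le> f j"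
      using least_root_mult_power_le[of "f j" r "n - j" x] g j by blast
  qed
qed

section \<open>Splitting monic polynomial functions\<close>

lemma monic_linear_factor:
  fixes f :: "nat \<Rightarrow> 'a::linordered_idempotent_semifield"
  assumes "r * c = 1"
    and dom: "\<And>j. j \<le> n \<Longrightarrow> f j \<le> r ^ (Suc n - j)"
    and least: "\<And>x. x < r \<Longrightarrow> \<exists>j\<le>n. r * x ^ (n - j) \<le> f j"
  shows "(\<Sum>j<Suc n. f j * x ^ j) + x ^ Suc n
       = (x + r) * ((\<Sum>j<n. (c * f j) * x ^ j) + x ^ n)"
proof -
  have rc: "r * (c * z) = z" for z using assms(1) by (metis mult.assoc mult_1)
  have c: "r \<noteq> 0" using assms(1) by auto
  have rsum: "r * (\<Sum>j<n. (c * f j) * x ^ j) = (\<Sum>j<n. f j * x ^ j)"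
    using rc by (simp add: sum_distrib_left mult.assoc)
  show ?thesis
  \<comment> \<open>From \<open>r\<close> on, both sides equal \<open>x^(n+1)\<close>; below
    \<open>r\<close>, both equal the sum of \<open>f j * x^j\<close> over \<open>j < n\<close> plus
    \<open>r * x^n\<close>.\<close>
  proof (cases "r \<le> x")
    case True
    \<comment> \<open>Of the \<open>n+1-j\<close> factors \<open>r\<close> bounding
      \<open>f j\<close>, one is kept and the others are raised to \<open>x\<close>.\<close>
    have summand_le: "f j * x ^ j \<le> r * x ^ n" if "j \<le> n" for j
    proof -
      have "f j * x ^ j \<le> (r * r ^ (n - j)) * x ^ j"
        using dom[OF that] that by (intro mult_mono_semifield) (auto simp: Suc_diff_le)
      also have "\<dots> \<le> (r * x ^ (n - j)) * x ^ j"
        using True by (intro mult_mono_semifield power_mono_semifield order_refl)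
      also have "\<dots> = r * x ^ n" using that by (simp add: mult.assoc flip: power_add)
      finally show ?thesis .
    qed
    have "r * (\<Sum>j<n. (c * f j) * x ^ j) \<le> r * x ^ n"
      unfolding rsum using summand_le by (simp add: sum_le_iff)
    then have q: "(\<Sum>j<n. (c * f j) * x ^ j) \<le> x ^ n"
      using mult_le_cancel[OF c] by blast
    have "r * x ^ n \<le> x ^ Suc n" using True by (auto intro: mult_mono_semifield)
    then have "(\<Sum>j<Suc n. f j * x ^ j) \<le> x ^ Suc n"
      unfolding sum_le_iff[OF finite_lessThan]
      using summand_le by (meson lessThan_iff less_Suc_eq_le order_trans)
    then show ?thesis using q True by (simp only: add_absorb power_Suc)
  next
    case False
    then have less: "x < r" by simp
    then obtain j where j: "j \<le> n" "r * x ^ (n - j) \<le> f j" using least by blast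
    have "r * x ^ n = r * x ^ (n - j) * x ^ j"
      using j(1) by (simp add: mult.assoc flip: power_add)
    also have "\<dots> \<le> f j * x ^ j" using j(2) by (auto intro: mult_mono_semifield)
    also have "\<dots> \<le> (\<Sum>j<Suc n. f j * x ^ j)"
      using j(1) by (intro member_le_sum) auto
    finally have lower: "r * x ^ n \<le> (\<Sum>j<Suc n. f j * x ^ j)" .
    have fn: "f n * x ^ n \<le> r * x ^ n"
      using dom[of n] by (intro mult_mono_semifield) auto
    have xn: "x ^ Suc n \<le> r * x ^ n"
      using less by (auto intro: mult_mono_semifield)
    \<comment> \<open>Both \<open>f n * x^n\<close> and \<open>x^(n+1)\<close> lie below
      \<open>r * x^n\<close>, which the full sum absorbs, so it can replace them.\<close>
    have "(\<Sum>j<Suc n. f j * x ^ j) + x ^ Suc n = (\<Sum>j<n. f j * x ^ j) + r * x ^ n"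
    proof (rule antisym)
      show "(\<Sum>j<Suc n. f j * x ^ j) + x ^ Suc n \<le> (\<Sum>j<n. f j * x ^ j) + r * x ^ n"
        using fn xn by (auto simp: add_le_iff intro: add_increasing add_increasing2)
      show "(\<Sum>j<n. f j * x ^ j) + r * x ^ n \<le> (\<Sum>j<Suc n. f j * x ^ j) + x ^ Suc n"
        using add_increasing2[OF zero_le lower, of "x ^ Suc n"]
        by (simp add: add_le_iff add.assoc add_increasing2)
    qed
    also have "\<dots> = r * ((\<Sum>j<n. (c * f j) * x ^ j) + x ^ n)"
      using rsum by (simp add: distrib_left)
    finally show ?thesis using less by (simp add: add_absorb)
  qed
qed

text \<open>Keeping the leading term apart from a free coefficient function lets the induction pass
  to \<open>c * f j\<close> without tracking degrees.\<close>

lemma monic_splits: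
  fixes f :: "nat \<Rightarrow> 'a::linordered_idempotent_semifield"
  assumes pre: "preradicable TYPE('a)"
  shows "\<exists>r. \<forall>x. (\<Sum>j<n. f j * x ^ j) + x ^ n = (\<Prod>i = 1..n. x + r i)"
proof (induction n arbitrary: f)
  case 0
  show ?case by simp
next
  case (Suc n)
  obtain r where r: "\<And>j. j \<le> n \<Longrightarrow> f j \<le> r ^ (Suc n - j)"
    "\<And>x. x < r \<Longrightarrow> \<exists>j\<le>n. r * x ^ (n - j) \<le> f j"
    using least_dominating_root[OF pre] by metis
  show ?case
  proof (cases "r = 0")
    case True
    \<comment> \<open>The exponent \<open>n+1-j\<close> is positive, so domination by
      \<open>0\<close> leaves only \<open>x^(n+1)\<close>.\<close>
    have "f j = 0" if "j < Suc n" for j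
      using r(1)[of j] that True by (simp add: power_0_left)
    then show ?thesis by (intro exI[of _ "\<lambda>_. 0"]) simp
  next
    case False
    then obtain c where c: "r * c = 1" using mult_inverse_ex by blast
    obtain s where s: "\<And>x. (\<Sum>j<n. (c * f j) * x ^ j) + x ^ n = (\<Prod>i = 1..n. x + s i)"
      using Suc.IH[of "\<lambda>j. c * f j"] by blast
    have "(\<Sum>j<Suc n. f j * x ^ j) + x ^ Suc n = (\<Prod>i = 1..Suc n. x + (s(Suc n := r)) i)" for x
    proof -
      have "(\<Prod>i = 1..n. x + (s(Suc n := r)) i) = (\<Prod>i = 1..n. x + s i)"
        by (rule prod.cong) auto
      then show ?thesis
        using monic_linear_factor[OF c r, where x = x] s by (simp add: mult.commute)
    qed
    then show ?thesis by blast
  qed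
qed

lemma preradicable_imp_algebraically_closed:
  assumes "preradicable TYPE('a::linordered_idempotent_semifield)"
  shows "algebraically_closed TYPE('a)"
  unfolding algebraically_closed_def
proof (intro allI impI)
  fix p :: "'a poly"
  assume "degree p > 0"
  then have "coeff p (degree p) \<noteq> 0" by auto
  then obtain c where c: "coeff p (degree p) * c = 1" using mult_inverse_ex by blast
  obtain r where r: "\<And>x. (\<Sum>j<degree p. (c * coeff p j) * x ^ j) + x ^ degree p
      = (\<Prod>i = 1..degree p. x + r i)"
    using monic_splits[OF assms, where n = "degree p" and f = "\<lambda>j. c * coeff p j"] by blast
  have "poly p x = coeff p (degree p) * (\<Prod>i = 1..degree p. x + r i)" for x
  proof -
    have cancel: "coeff p (degree p) * (c * z) = z" for z
      using c by (metis mult.assoc mult_1)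
    have "poly p x = (\<Sum>j<degree p. coeff p j * x ^ j) + coeff p (degree p) * x ^ degree p"
      by (simp add: poly_altdef flip: lessThan_Suc_atMost)
    then show ?thesis
      unfolding r[symmetric] by (simp add: distrib_left sum_distrib_left mult.assoc cancel)
  qed
  then show "\<exists>r. \<forall>x. poly p x = coeff p (degree p) * (\<Prod>i = 1..degree p. x + r i)" by blast
qed

section \<open>Least roots from a splitting of \<open>x^n + y\<close>\<close>

lemma algebraically_closed_imp_preradicable:
  assumes "algebraically_closed TYPE('a::linordered_idempotent_semifield)"
  shows "preradicable TYPE('a)"
  unfolding preradicable_def
proof (intro allI impI)
  fix y :: 'a and n :: nat
  assume n: "n > 0"
  show "\<exists>x. y \<le> x ^ n \<and> (\<forall>z. y \<le> z ^ n \<longrightarrow> x \<le> z)"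
  proof (cases "y = 0")
    case True
    then show ?thesis by (intro exI[of _ 0]) auto
  next
    case False
    define p where "p = monom 1 n + [:y:]"
    have deg: "degree p = n"
      unfolding p_def using n by (subst degree_add_eq_left) (auto simp: degree_monom_eq)
    have lc: "coeff p n = 1" using n by (cases n) (auto simp: p_def)
    have poly: "poly p x = x ^ n + y" for x by (simp add: p_def poly_monom)
    obtain r where r: "\<And>x. x ^ n + y = (\<Prod>i = 1..n. x + r i)"
      using assms n deg lc poly unfolding algebraically_closed_def by (metis mult_1)
    define m where "m = Max (r ` {1..n})"
    have "m \<in> r ` {1..n}" unfolding m_def using n by (intro Max_in) auto
    then obtain k where k: "k \<in> {1..n}" "m = r k" by blast
    have le: "r i \<le> m" if "i \<in> {1..n}" for i using that by (simp add: m_def)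
    \<comment> \<open>At the largest root every factor collapses to \<open>m\<close>, so
      \<open>y\<close> is absorbed by \<open>m^n\<close>.\<close>
    have "(\<Prod>i = 1..n. m + r i) = (\<Prod>i = 1..n. m)"
      using le by (intro prod.cong) (auto simp: add_absorb)
    then have "m ^ n + y = m ^ n" using r[of m] by simp
    then have "y \<le> m ^ n" by (metis le_iff_add add.commute)
    moreover have "m \<le> z" if "y \<le> z ^ n" for z
    proof (rule ccontr)
      assume "\<not> m \<le> z"
      then have "z < m" by simp
      have "z \<noteq> 0" using that False n by (auto simp: power_0_left)
      \<comment> \<open>Factor \<open>k\<close> equals \<open>m\<close> and the others are at least
        \<open>z\<close>, so \<open>z^(n-1) * m \<le> z^n\<close>; cancelling \<open>z^(n-1)\<close>
        gives \<open>m \<le> z\<close>.\<close>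
      have "z ^ n = (\<Prod>i = 1..n. z + r i)"
        using r[of z] that by (simp add: add_absorb)
      also have "\<dots> = m * (\<Prod>i \<in> {1..n} - {k}. z + r i)"
        using k \<open>z < m\<close> by (subst prod.remove[of _ k]) (auto simp: add_absorb)
      also have "\<dots> \<ge> m * (\<Prod>i \<in> {1..n} - {k}. z)"
        by (intro mult_mono_semifield prod_mono_semifield order_refl) (simp add: le_iff_add, blast)
      also have "(\<Prod>i \<in> {1..n} - {k}. z) = z ^ (n - 1)" using k(1) by simp
      finally have "z ^ (n - 1) * m \<le> z ^ (n - 1) * z"
        using n by (simp add: mult.commute power_eq_if)
      then have "m \<le> z"
        using mult_le_cancel[OF power_nonzero[OF \<open>z \<noteq> 0\<close>]] by blast
      then show False using \<open>z < m\<close> by simp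
    qed
    ultimately show ?thesis by blast
  qed
qed

theorem theorem6p6:
  assumes "infinite (UNIV :: 'a::linordered_idempotent_semifield set)"
  shows "algebraically_closed TYPE('a) \<longleftrightarrow> preradicable TYPE('a)"
  using algebraically_closed_imp_preradicable preradicable_imp_algebraically_closed by blast

end
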